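(* Let $U$ be a non-empty open subset of $\mathbb{R}$. For every $f\in C^{\infty}(U)$ there is $g\in C^{\infty}(\mathbb{R})$ such that (i) $U\subseteq \operatorname{coz} g$, and (ii) the function $f\cdot g|_U$ on $U$ extends to a function $h\in C^{\infty}(\mathbb{R})$, i.e. there is $h\in C^{\infty}(\mathbb{R})$ with $f\cdot g|_U = h|_U$.
   Context: For an open set $W\subseteq\mathbb{R}$, $C^{\infty}(W)$ denotes the ring of real valued functions on $W$ having derivatives of all orders on $W$ (no boundedness of the function or of its derivatives is assumed). For $g\colon\mathbb{R}\to\mathbb{R}$ continuous, $\operatorname{coz} g=\{x\in\mathbb{R}\mid g(x)\neq 0\}$. *)

theory Defs
  imports "HOL-Analysis.Analysis"
begin

(* A function on an open set W is represented by a total function whose values outside W are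
   irrelevant: since W is open, differentiability and the value of deriv at a point of W depend
   only on the restriction of the function to W, and likewise for all iterates of deriv. *)
definition C_infinity :: "real set \<Rightarrow> (real \<Rightarrow> real) set" where
  "C_infinity W = {f. \<forall>n. \<forall>x\<in>W. (deriv ^^ n) f field_differentiable (at x)}"

definition coz :: "(real \<Rightarrow> real) \<Rightarrow> real set" where
  "coz g = {x. g x \<noteq> 0}"

end

(* Cover U by countably many intervals (a n, b n) with [a n, b n] contained in U and let phi n be a
   smooth bump that is positive exactly on (a n, b n).  Both phi n and f * phi n are smooth on the
   whole line with compact support, hence have bounded derivatives of every order.  Weights c n > 0
   that decrease fast enough therefore make all termwise differentiated series of
   g = sum c n * phi n and f * g = sum c n * f * phi n converge uniformly. *)
theory Submission
  imports Defs
begin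

section \<open>Smooth functions on open sets\<close>

lemma C_infinity_DERIV:
  assumes "f \<in> C_infinity W" "x \<in> W"
  shows "((deriv ^^ n) f has_field_derivative (deriv ^^ Suc n) f x) (at x)"
  using assms by (simp add: C_infinity_def DERIV_deriv_iff_field_differentiable)

lemma C_infinity_deriv: "f \<in> C_infinity W \<Longrightarrow> deriv f \<in> C_infinity W"
proof -
  assume "f \<in> C_infinity W"
  then have "(deriv ^^ Suc n) f field_differentiable at x" if "x \<in> W" for n x
    using that unfolding C_infinity_def by blast
  then show "deriv f \<in> C_infinity W"
    unfolding C_infinity_def funpow_Suc_right by simp
qed

lemma C_infinity_subset: "f \<in> C_infinity W \<Longrightarrow> V \<subseteq> W \<Longrightarrow> f \<in> C_infinity V"
  unfolding C_infinity_def by blast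

lemma C_infinity_Un: "f \<in> C_infinity V \<Longrightarrow> f \<in> C_infinity W \<Longrightarrow> f \<in> C_infinity (V \<union> W)"
  unfolding C_infinity_def by blast

text \<open>Openness turns agreement on \<open>W\<close> into agreement near each of its points, and
  \<open>deriv\<close> sees only the germ of a function, so induction on the order applies.\<close>

lemma higher_deriv_cong_open:
  fixes f g :: "real \<Rightarrow> real"
  assumes "open W" "\<And>x. x \<in> W \<Longrightarrow> f x = g x" "x \<in> W"
  shows "(deriv ^^ n) f x = (deriv ^^ n) g x"
  using assms(3)
proof (induction n arbitrary: x)
  case (Suc n)
  have "eventually (\<lambda>y. (deriv ^^ n) f y = (deriv ^^ n) g y) (nhds x)"
    using eventually_nhds_in_open[OF assms(1) Suc.prems] by eventually_elim (rule Suc.IH)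
  then show ?case
    by (simp add: deriv_cong_ev)
qed (simp add: assms)

text \<open>By induction each iterate of \<open>deriv\<close> on \<open>f\<close> agrees on the open
  set \<open>W\<close> with a member of \<open>F\<close>, and is therefore differentiable there.
  Smoothness thus reduces to finding a family closed under differentiation, with no formula for the
  n-th derivative.\<close>

lemma C_infinity_coinduct:
  assumes "open W" "f \<in> F"
    and step: "\<And>g. g \<in> F \<Longrightarrow> \<exists>g'\<in>F. \<forall>x\<in>W. (g has_field_derivative g' x) (at x)"
  shows "f \<in> C_infinity W"
proof -
  have *: "\<exists>g\<in>F. \<forall>x\<in>W. (deriv ^^ n) f x = g x" for n
  proof (induction n)
    case (Suc n)
    then obtain g where g: "g \<in> F" "\<And>x. x \<in> W \<Longrightarrow> (deriv ^^ n) f x = g x" by blast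
    obtain g' where g': "g' \<in> F" "\<And>x. x \<in> W \<Longrightarrow> (g has_field_derivative g' x) (at x)"
      using step[OF g(1)] by blast
    have "(deriv ^^ Suc n) f x = g' x" if "x \<in> W" for x
    proof -
      have "((deriv ^^ n) f has_field_derivative g' x) (at x)"
        using has_field_derivative_transform_within_open[OF g'(2)[OF that] assms(1) that]
        by (simp add: g(2))
      then show ?thesis by (simp add: DERIV_imp_deriv)
    qed
    then show ?case using g'(1) by blast
  qed (use assms in auto)
  show ?thesis
    unfolding C_infinity_def
  proof (intro CollectI allI ballI)
    fix n x assume x: "x \<in> W"
    obtain g where g: "g \<in> F" "\<And>x. x \<in> W \<Longrightarrow> (deriv ^^ n) f x = g x" using * by blast
    obtain g' where g': "g' \<in> F" "\<And>x. x \<in> W \<Longrightarrow> (g has_field_derivative g' x) (at x)"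
      using step[OF g(1)] by blast
    have "((deriv ^^ n) f has_field_derivative g' x) (at x)"
      using has_field_derivative_transform_within_open[OF g'(2)[OF x] assms(1) x]
      by (simp add: g(2))
    then show "(deriv ^^ n) f field_differentiable at x"
      by (auto simp: field_differentiable_def)
  qed
qed

lemma C_infinity_0: "open W \<Longrightarrow> (\<lambda>x. 0) \<in> C_infinity W"
  by (rule C_infinity_coinduct[where F = "{\<lambda>x. 0}"]) auto

lemma C_infinity_cong_open:
  assumes "open W" "f \<in> C_infinity W" "\<And>x. x \<in> W \<Longrightarrow> f x = g x"
  shows "g \<in> C_infinity W"
  unfolding C_infinity_def
proof (intro CollectI allI ballI)
  fix n x assume x: "x \<in> W"
  have "((deriv ^^ n) g has_field_derivative (deriv ^^ Suc n) f x) (at x)"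
    using has_field_derivative_transform_within_open[OF C_infinity_DERIV[OF assms(2) x, of n] assms(1) x]
      higher_deriv_cong_open[OF assms(1,3)] by simp
  then show "(deriv ^^ n) g field_differentiable at x"
    by (auto simp: field_differentiable_def)
qed

text \<open>The derivative of a product is a sum of two products. Closing the products under
  addition gives a family closed under differentiation, which replaces the Leibniz formula for
  higher derivatives.\<close>

inductive_set product_sums :: "real set \<Rightarrow> (real \<Rightarrow> real) set" for W where
  prod: "f \<in> C_infinity W \<Longrightarrow> g \<in> C_infinity W \<Longrightarrow> (\<lambda>x. f x * g x) \<in> product_sums W"
| add: "f \<in> product_sums W \<Longrightarrow> g \<in> product_sums W \<Longrightarrow> (\<lambda>x. f x + g x) \<in> product_sums W"

lemma C_infinity_mult:
  assumes "open W" "f \<in> C_infinity W" "g \<in> C_infinity W"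
  shows "(\<lambda>x. f x * g x) \<in> C_infinity W"
proof (rule C_infinity_coinduct[OF assms(1) product_sums.prod[OF assms(2,3)]])
  fix k assume "k \<in> product_sums W"
  then show "\<exists>k'\<in>product_sums W. \<forall>x\<in>W. (k has_field_derivative k' x) (at x)"
  proof induction
    case (prod f g)
    have "(\<lambda>x. deriv f x * g x + deriv g x * f x) \<in> product_sums W"
      by (rule product_sums.add[OF product_sums.prod product_sums.prod])
        (simp_all add: C_infinity_deriv prod)
    moreover have "((\<lambda>x. f x * g x) has_field_derivative deriv f x * g x + deriv g x * f x) (at x)"
      if "x \<in> W" for x
      using DERIV_mult[OF C_infinity_DERIV[OF prod(1) that, of 0] C_infinity_DERIV[OF prod(2) that, of 0]]
      by simp
    ultimately show ?case by (intro bexI ballI)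
  next
    case (add f g)
    obtain f' where f': "f' \<in> product_sums W" "\<forall>x\<in>W. (f has_field_derivative f' x) (at x)"
      using add.IH(1) by blast
    obtain g' where g': "g' \<in> product_sums W" "\<forall>x\<in>W. (g has_field_derivative g' x) (at x)"
      using add.IH(2) by blast
    show ?case
      using f'(2) g'(2)
      by (intro bexI[OF _ product_sums.add[OF f'(1) g'(1)]] ballI DERIV_add) blast+
  qed
qed

lemma C_infinity_affine:
  assumes "f \<in> C_infinity UNIV"
  shows "(\<lambda>x. f (c * x + d)) \<in> C_infinity UNIV"
\<comment> \<open>The scalar \<open>r\<close> absorbs the factor \<open>c\<close> that the chain
  rule contributes at each differentiation.\<close>
proof (rule C_infinity_coinduct[where F = "{\<lambda>x. r * w (c * x + d) |r w. w \<in> C_infinity UNIV}"])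
  show "(\<lambda>x. f (c * x + d)) \<in> {\<lambda>x. r * w (c * x + d) |r w. w \<in> C_infinity UNIV}"
    using assms by (intro CollectI exI[of _ 1] exI[of _ f]) auto
next
  fix k assume "k \<in> {\<lambda>x. r * w (c * x + d) |r w. w \<in> C_infinity UNIV}"
  then obtain r w where k: "k = (\<lambda>x. r * w (c * x + d))" and w: "w \<in> C_infinity UNIV" by blast
  have "((\<lambda>x. w (c * x + d)) has_field_derivative deriv w (c * x + d) * c) (at x)" for x
    by (rule DERIV_chain2[OF C_infinity_DERIV[OF w, of _ 0, simplified]])
      (auto intro!: derivative_eq_intros)
  then have "(k has_field_derivative r * c * deriv w (c * x + d)) (at x)" for x
    unfolding k by (auto intro!: derivative_eq_intros)
  then show "\<exists>k'\<in>{\<lambda>x. r * w (c * x + d) |r w. w \<in> C_infinity UNIV}.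
      \<forall>x\<in>UNIV. (k has_field_derivative k' x) (at x)"
    using C_infinity_deriv[OF w]
    by (intro bexI[of _ "\<lambda>x. r * c * deriv w (c * x + d)"]) auto
qed simp

section \<open>Smooth bump functions\<close>

text \<open>For \<open>p = 1\<close> this is the classical function that is smooth but not analytic
  at 0. The polynomial factor makes the family closed under differentiation.\<close>

definition exp_glue :: "real poly \<Rightarrow> real \<Rightarrow> real" where
  "exp_glue p x = (if x > 0 then poly p (1 / x) * exp (- (1 / x)) else 0)"

lemma poly_times_exp_tendsto_0:
  fixes p :: "real poly"
  shows "((\<lambda>y. poly p y * exp (- y)) \<longlongrightarrow> 0) at_top"
proof -
  have "((\<lambda>y. \<Sum>i\<le>degree p. coeff p i * (y ^ i / exp y)) \<longlongrightarrow> (\<Sum>i\<le>degree p. coeff p i * 0)) at_top"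
    by (intro tendsto_sum tendsto_mult tendsto_const tendsto_power_div_exp_0)
  then show ?thesis
    by (simp add: poly_altdef sum_distrib_right exp_minus divide_inverse mult.assoc)
qed

text \<open>For positive \<open>x\<close> put y = 1/x, so that dy/dx = -y^2. The chain rule turns
  p(y) exp(-y) into y^2 (p(y) - p'(y)) exp(-y), and \<open>[:0, 0, 1:]\<close> is y^2. At 0
  exponential decay beats every polynomial in y.\<close>

lemma exp_glue_DERIV:
  "(exp_glue p has_field_derivative exp_glue ([:0, 0, 1:] * (p - pderiv p)) x) (at x)"
proof -
  consider "x > 0" | "x < 0" | "x = 0" by linarith
  then show ?thesis
  proof cases
    case 1
    have "((\<lambda>x. poly p (1 / x) * exp (- (1 / x))) has_field_derivative
        exp_glue ([:0, 0, 1:] * (p - pderiv p)) x) (at x)"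
      using 1 by (auto intro!: derivative_eq_intros DERIV_chain2[OF poly_DERIV]
          simp: exp_glue_def field_simps power2_eq_square)
    then show ?thesis
      by (rule has_field_derivative_transform_within_open[of _ _ _ "{0<..}"])
        (use 1 in \<open>auto simp: exp_glue_def\<close>)
  next
    case 2
    have "((\<lambda>x. 0) has_field_derivative exp_glue ([:0, 0, 1:] * (p - pderiv p)) x) (at x)"
      using 2 by (simp add: exp_glue_def)
    then show ?thesis
      by (rule has_field_derivative_transform_within_open[of _ _ _ "{..<0}"])
        (use 2 in \<open>auto simp: exp_glue_def\<close>)
  next
    case 3
    \<comment> \<open>To the right of 0 the difference quotient \<open>exp_glue p x / x\<close> is y
      p(y) exp(-y) with y = 1/x; the extra factor y is \<open>[:0, 1:]\<close>.\<close>
    have "((\<lambda>x. poly ([:0, 1:] * p) (inverse x) * exp (- inverse x)) \<longlongrightarrow> 0) (at_right (0::real))"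
      by (rule filterlim_compose[OF poly_times_exp_tendsto_0 filterlim_inverse_at_top_right])
    then have r: "((\<lambda>x. exp_glue p x / x) \<longlongrightarrow> 0) (at_right 0)"
      by (rule Lim_transform_eventually)
        (auto simp: exp_glue_def field_simps eventually_at_filter)
    have l: "((\<lambda>x. exp_glue p x / x) \<longlongrightarrow> 0) (at_left 0)"
      by (rule Lim_transform_eventually[OF tendsto_const])
        (auto simp: exp_glue_def eventually_at_filter)
    have "((\<lambda>x. exp_glue p x / x) \<longlongrightarrow> 0) (at 0)"
      using l r by (rule filterlim_split_at)
    then show ?thesis
      by (simp add: has_field_derivative_iff 3 exp_glue_def)
  qed
qed

lemma exp_glue_C_infinity: "exp_glue p \<in> C_infinity UNIV"
proof (rule C_infinity_coinduct[of _ _ "range exp_glue"])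
  show "\<exists>g'\<in>range exp_glue. \<forall>x\<in>UNIV. (g has_field_derivative g' x) (at x)"
    if "g \<in> range exp_glue" for g
    using that exp_glue_DERIV by blast
qed auto

definition bump :: "real \<Rightarrow> real \<Rightarrow> real \<Rightarrow> real" where
  "bump a b x = exp_glue 1 (x - a) * exp_glue 1 (b - x)"

lemma bump_C_infinity: "bump a b \<in> C_infinity UNIV"
  using C_infinity_mult[OF _ C_infinity_affine[OF exp_glue_C_infinity[of 1], of 1 "- a"]
      C_infinity_affine[OF exp_glue_C_infinity[of 1], of "- 1" b]]
  by (simp add: bump_def[abs_def])

lemma bump_pos: "a < x \<Longrightarrow> x < b \<Longrightarrow> bump a b x > 0"
  and bump_eq_0: "x \<notin> {a<..<b} \<Longrightarrow> bump a b x = 0"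
  and bump_nonneg: "bump a b x \<ge> 0"
  by (auto simp: bump_def exp_glue_def)

(* The arbitrary values of f outside U are harmless, because the bump vanishes there. *)
lemma mult_bump_C_infinity:
  assumes "open U" "f \<in> C_infinity U" "{a..b} \<subseteq> U"
  shows "(\<lambda>x. f x * bump a b x) \<in> C_infinity UNIV"
proof -
  have "(\<lambda>x. f x * bump a b x) \<in> C_infinity U"
    using assms C_infinity_mult C_infinity_subset[OF bump_C_infinity] by blast
  moreover have "(\<lambda>x. f x * bump a b x) \<in> C_infinity (- {a..b})"
    by (rule C_infinity_cong_open[OF _ C_infinity_0]) (auto simp: bump_eq_0)
  \<comment> \<open>Smoothness is a pointwise condition, and the two open sets cover the line
    because the closed interval lies in \<open>U\<close>.\<close>
  ultimately have "(\<lambda>x. f x * bump a b x) \<in> C_infinity (U \<union> - {a..b})"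
    by (rule C_infinity_Un)
  then show ?thesis
    by (rule C_infinity_subset) (use assms in auto)
qed

section \<open>Bounded derivatives and termwise differentiation of series\<close>

text \<open>Each derivative is continuous, hence bounded on the compact interval, and it vanishes on
  the open complement together with \<open>f\<close>.\<close>

lemma higher_deriv_bounded:
  assumes "f \<in> C_infinity UNIV" "\<And>x. x \<notin> {a..b} \<Longrightarrow> f x = 0"
  shows "\<exists>M. \<forall>x. \<bar>(deriv ^^ k) f x\<bar> \<le> M"
proof -
  have "continuous_on {a..b} ((deriv ^^ k) f)"
    using C_infinity_DERIV[OF assms(1)] by (blast intro: DERIV_isCont continuous_at_imp_continuous_on)
  then have "bounded ((deriv ^^ k) f ` {a..b})"
    by (intro compact_imp_bounded compact_continuous_image) auto
  then obtain M where M: "\<And>x. x \<in> {a..b} \<Longrightarrow> \<bar>(deriv ^^ k) f x\<bar> \<le> M"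
    unfolding bounded_iff real_norm_def by blast
  have z: "(deriv ^^ k) (\<lambda>x. 0) = (\<lambda>x. 0 :: real)"
    by (induction k) auto
  have "(deriv ^^ k) f x = 0" if "x \<notin> {a..b}" for x
    using higher_deriv_cong_open[of "- {a..b}" f "\<lambda>x. 0" x k] assms(2) that
    by (simp add: z open_Compl del: atLeastAtMost_iff)
  \<comment> \<open>The maximum covers the zero values off the interval; \<open>M\<close> itself may
    be negative if the interval is empty.\<close>
  then have "\<bar>(deriv ^^ k) f x\<bar> \<le> max M 0" for x
    using M[of x] by (cases "x \<in> {a..b}") auto
  then show ?thesis by blast
qed

text \<open>For a fixed order \<open>k\<close> the bound fails to apply only to the finitely many
  terms with \<open>n < k\<close>, so the Weierstrass test, which needs it only eventually, handles
  every order with one sequence of weights.\<close>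

lemma suminf_C_infinity:
  fixes u :: "nat \<Rightarrow> real \<Rightarrow> real"
  assumes u: "\<And>n. u n \<in> C_infinity UNIV"
    and bd: "\<And>n k x. k \<le> n \<Longrightarrow> \<bar>c n * (deriv ^^ k) (u n) x\<bar> \<le> (1 / 2) ^ n"
  shows "(\<lambda>x. \<Sum>n. c n * u n x) \<in> C_infinity UNIV"
    and "summable (\<lambda>n. c n * u n x)"
proof -
  have sm: "summable (\<lambda>n. c n * (deriv ^^ k) (u n) x)" for k x
    by (rule summable_comparison_test_ev[of _ "\<lambda>n. (1 / 2) ^ n"])
      (auto intro!: eventually_mono[OF eventually_ge_at_top[of k]] bd)
  from sm[of 0] show "summable (\<lambda>n. c n * u n x)" by simp
  define S where "S k x = (\<Sum>n. c n * (deriv ^^ k) (u n) x)" for k x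
  have "(S k has_field_derivative S (Suc k) x) (at x)" for k x
  proof -
    \<comment> \<open>Uniform convergence of the series of derivatives of the next order justifies
      differentiating \<open>S k\<close> term by term; the range of \<open>S\<close> is then closed
      under differentiation.\<close>
    have "uniformly_convergent_on UNIV (\<lambda>m x. \<Sum>n<m. c n * (deriv ^^ Suc k) (u n) x)"
      by (rule Weierstrass_m_test'_ev[of _ _ "\<lambda>n. (1 / 2) ^ n"])
        (use bd[of "Suc k"] in \<open>auto intro!: eventually_mono[OF eventually_ge_at_top[of "Suc k"]]\<close>)
    then show ?thesis
      unfolding S_def[abs_def]
      by (intro has_field_derivative_series'(2)[where S = UNIV and ?x0.0 = 0])
        (auto intro!: sm DERIV_cmult C_infinity_DERIV[OF u, simplified])
  qed
  then have "S 0 \<in> C_infinity UNIV"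
    by (intro C_infinity_coinduct[of _ _ "range S"]) auto
  then show "(\<lambda>x. \<Sum>n. c n * u n x) \<in> C_infinity UNIV"
    by (simp add: S_def[abs_def])
qed

section \<open>Countable cover by intervals\<close>

text \<open>Rational endpoints make the family countable, and density of the rationals puts such an
  interval around each point of \<open>U\<close>. Closed intervals inside \<open>U\<close> are what
  \<open>mult_bump_C_infinity\<close> asks for.\<close>

lemma countable_interval_cover:
  fixes U :: "real set"
  assumes "open U"
  obtains a b :: "nat \<Rightarrow> real"
  where "\<And>n. {a n..b n} \<subseteq> U" "\<And>x. x \<in> U \<Longrightarrow> \<exists>n. a n < x \<and> x < b n"
proof -
  define D where "D = {I \<in> \<rat> \<times> \<rat>. {fst I..snd I} \<subseteq> U}"
  have "countable D"
    unfolding D_def by (intro countable_Collect countable_SIGMA countable_rat)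
  \<comment> \<open>The interval from 1 to 0 is empty, so this pair shows that \<open>D\<close> is
    nonempty, as enumeration by \<open>from_nat_into\<close> requires.\<close>
  moreover have "(1, 0) \<in> D"
    by (simp add: D_def)
  ultimately have r: "range (from_nat_into D) = D"
    by (intro range_from_nat_into) blast+
  have "from_nat_into D n \<in> D" for n
    using r by blast
  then have "{fst (from_nat_into D n)..snd (from_nat_into D n)} \<subseteq> U" for n
    unfolding D_def by blast
  moreover have "\<exists>n. fst (from_nat_into D n) < x \<and> x < snd (from_nat_into D n)" if x: "x \<in> U" for x
  proof -
    obtain e where e: "e > 0" "ball x e \<subseteq> U"
      using openE[OF assms x] .
    obtain p where p: "p \<in> \<rat>" "x - e < p" "p < x"
      using Rats_dense_in_real[of "x - e" x] e by auto
    obtain q where q: "q \<in> \<rat>" "x < q" "q < x + e"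
      using Rats_dense_in_real[of x "x + e"] e by auto
    have "{p..q} \<subseteq> ball x e"
      unfolding subset_iff mem_ball dist_real_def using p q by auto
    then have "(p, q) \<in> D"
      using p(1) q(1) e(2) unfolding D_def by simp
    then obtain n where "from_nat_into D n = (p, q)"
      using r by (metis rangeE)
    then show ?thesis
      using p q by (intro exI[of _ n]) auto
  qed
  ultimately show ?thesis by (rule that)
qed

section \<open>Choice of weights and the two series\<close>

theorem theorem2p1:
  fixes U :: "real set" and f :: "real \<Rightarrow> real"
  assumes "open U" and "U \<noteq> {}" and "f \<in> C_infinity U"
  shows "\<exists>g \<in> C_infinity UNIV. U \<subseteq> coz g \<and> (\<exists>h \<in> C_infinity UNIV. \<forall>x\<in>U. f x * g x = h x)"
proof -
  obtain a b where ab: "\<And>n. {a n..b n} \<subseteq> U" "\<And>x. x \<in> U \<Longrightarrow> \<exists>n::nat. a n < x \<and> x < b n"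
    using countable_interval_cover[OF assms(1)] by blast
  define u where "u n = bump (a n) (b n)" for n
  define v where "v n = (\<lambda>x. f x * bump (a n) (b n) x)" for n
  have u: "u n \<in> C_infinity UNIV" and v: "v n \<in> C_infinity UNIV" for n
    unfolding u_def v_def using bump_C_infinity mult_bump_C_infinity assms(1,3) ab(1) by blast+
  have "\<forall>n k. \<exists>M. \<forall>x. \<bar>(deriv ^^ k) (u n) x\<bar> \<le> M"
  proof (intro allI)
    show "\<exists>M. \<forall>x. \<bar>(deriv ^^ k) (u n) x\<bar> \<le> M" for n k
      by (rule higher_deriv_bounded[OF u, of "a n" "b n"]) (auto simp: u_def bump_eq_0)
  qed
  then obtain M where M: "\<And>n k x. \<bar>(deriv ^^ k) (u n) x\<bar> \<le> M n k"
    unfolding choice_iff by blast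
  have "\<forall>n k. \<exists>M. \<forall>x. \<bar>(deriv ^^ k) (v n) x\<bar> \<le> M"
  proof (intro allI)
    show "\<exists>M. \<forall>x. \<bar>(deriv ^^ k) (v n) x\<bar> \<le> M" for n k
      by (rule higher_deriv_bounded[OF v, of "a n" "b n"]) (auto simp: v_def bump_eq_0)
  qed
  then obtain N where N: "\<And>n k x. \<bar>(deriv ^^ k) (v n) x\<bar> \<le> N n k"
    unfolding choice_iff by blast
  \<comment> \<open>\<open>B n\<close> dominates all derivatives up to order \<open>n\<close> of
    both \<open>u n\<close> and \<open>v n\<close>, so the same weights serve both series; the
    summand 1 keeps it positive for the division in \<open>c n\<close>.\<close>
  define B where "B n = 1 + (\<Sum>k\<le>n. M n k + N n k)" for n
  define c where "c n = (1 / 2) ^ n / B n" for n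
  have M0: "M n k \<ge> 0" and N0: "N n k \<ge> 0" for n k
    using M[of k n 0] N[of k n 0] by linarith+
  have B: "M n k \<le> B n" "N n k \<le> B n" if "k \<le> n" for n k
  proof -
    have "M n k + N n k \<le> (\<Sum>k\<le>n. M n k + N n k)"
      using that by (intro member_le_sum) (auto intro!: add_nonneg_nonneg M0 N0)
    then show "M n k \<le> B n" "N n k \<le> B n"
      using M0[of n k] N0[of n k] unfolding B_def by linarith+
  qed
  have Bpos: "B n > 0" for n
    unfolding B_def using M0 N0 by (intro add_pos_nonneg sum_nonneg) auto
  have cpos: "c n > 0" for n
    using Bpos by (simp add: c_def)
  have weight: "\<bar>c n * t\<bar> \<le> (1 / 2) ^ n" if "\<bar>t\<bar> \<le> B n" for n t
  proof -
    have "\<bar>c n * t\<bar> \<le> c n * B n"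
      using that cpos[of n] by (simp add: abs_mult)
    also have "\<dots> = (1 / 2) ^ n"
      using Bpos[of n] by (simp add: c_def)
    finally show ?thesis .
  qed
  have bu: "\<bar>c n * (deriv ^^ k) (u n) x\<bar> \<le> (1 / 2) ^ n"
    and bv: "\<bar>c n * (deriv ^^ k) (v n) x\<bar> \<le> (1 / 2) ^ n" if "k \<le> n" for n k x
    using weight[OF order_trans[OF M B(1)[OF that]]] weight[OF order_trans[OF N B(2)[OF that]]] .
  let ?g = "\<lambda>x. \<Sum>n. c n * u n x" and ?h = "\<lambda>x. \<Sum>n. c n * v n x"
  have sum_u: "summable (\<lambda>n. c n * u n x)" for x
    by (rule suminf_C_infinity(2)[OF u bu])
  have "U \<subseteq> coz ?g"
  proof
    fix x assume "x \<in> U"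
    then obtain n where "a n < x" "x < b n" using ab(2) by blast
    then have "0 < c n * u n x"
      by (simp add: u_def cpos bump_pos)
    \<comment> \<open>All terms are nonnegative and the one whose interval contains \<open>x\<close>
      is positive.\<close>
    then have "?g x > 0"
      by (intro suminf_pos2[OF sum_u]) (auto simp: u_def bump_nonneg cpos less_imp_le)
    then show "x \<in> coz ?g" by (simp add: coz_def)
  qed
  \<comment> \<open>Since the weights agree, the factor \<open>f x\<close> passes through the sum
    term by term.\<close>
  moreover have "f x * ?g x = ?h x" for x
    using suminf_mult[OF sum_u, of "f x" x] by (simp add: u_def v_def mult_ac)
  ultimately show ?thesis
    by (intro bexI[OF _ suminf_C_infinity(1)[OF u bu]] bexI[OF _ suminf_C_infinity(1)[OF v bv]]
        conjI ballI)
qed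

end
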